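(* Let $\theta\in(0,2\pi)\setminus\mathbb{Q}\pi$. Then there exists a dense subset $S_\theta\subseteq(2,\infty)$ such that for every point $\xi\in\mathfrak{C}_\theta\cap(S_\theta\times\mathbb{R}\times\mathbb{R})$ the holonomy map $\rho_\xi$ satisfies $\rho_\xi(r^m)=1$ for some $r\in F_2\setminus\{1\}$ and some $m\ge2$. The analogous conclusions also hold for every $\xi\in\mathfrak{C}_\theta\cap(\mathbb{R}\times S_\theta\times\mathbb{R})$ and for every $\xi\in\mathfrak{C}_\theta\cap(\mathbb{R}\times\mathbb{R}\times S_\theta)$.
   Context: $F_2=\langle X,Y,Z\mid XYZ=1\rangle$ is the free group on $X,Y$, identified with $\pi_1(M)$ for $M$ a once-punctured torus. For $\theta\in(0,2\pi)$, the Fricke--Klein space $\mathfrak{C}_\theta$ of marked incomplete hyperbolic structures on $M$ with a single cone point of angle $\theta$ at the puncture is identified with $$\mathfrak{C}_\theta=\{(x,y,z)\in(2,\infty)^3\mid x^2+y^2+z^2-xyz-2=-2\cos(\theta/2)\},$$ where $x,y,z$ are the absolute values of the traces of the holonomies of $X,Y,Z$. For $\xi=(x,y,z)\in\mathfrak{C}_\theta$ the holonomy map $\rho_\xi\colon F_2\to\mathrm{PSL}(2,\mathbb{R})$ is well defined up to conjugation; up to conjugation by an isometry of $\mathbb{H}^2$ it is the projection to $\mathrm{PSL}(2,\mathbb{R})$ of the representation $\tilde\rho_\xi\colon F_2\to \mathrm{SL}(2,\mathbb{R})$ given by $$\tilde\rho_\xi(X)=\begin{pmatrix}x&-1\\1&0\end{pmatrix},\quad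 \tilde\rho_\xi(Y)=\begin{pmatrix}0&\zeta^{-1}\\-\zeta&y\end{pmatrix},\quad \zeta\ge1,\ \zeta+\zeta^{-1}=z,$$ for which $\mathrm{tr}\,\tilde\rho_\xi(X)=x$, $\mathrm{tr}\,\tilde\rho_\xi(Y)=y$, $\mathrm{tr}\,\tilde\rho_\xi(Z)=z$. *)

theory Defs
  imports "HOL-Analysis.Analysis" "HOL-Algebra.Coset"
begin

section \<open>The free group\<close>

text \<open>Elements of the free group on the type \<^typ>\<open>'a\<close> are the reduced words over the letters
  \<open>(g, True)\<close>, standing for \<open>g\<close>, and \<open>(g, False)\<close>, standing for \<open>g\<inverse>\<close>.\<close>

type_synonym 'a letter = "'a \<times> bool"

definition inv_letter :: "'a letter \<Rightarrow> 'a letter" where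
  "inv_letter a = (fst a, \<not> snd a)"

definition reduced :: "'a letter list \<Rightarrow> bool" where
  "reduced = successively (\<lambda>a b. b \<noteq> inv_letter a)"

fun cancel_cons :: "'a letter \<Rightarrow> 'a letter list \<Rightarrow> 'a letter list" where
  "cancel_cons a [] = [a]"
| "cancel_cons a (b # w) = (if b = inv_letter a then w else a # b # w)"

definition free_group :: "'a letter list monoid" where
  "free_group = \<lparr>carrier = {w. reduced w}, mult = (\<lambda>u v. foldr cancel_cons u v), one = []\<rparr>"

text \<open>The extension of a map \<open>f\<close> from the generators to a group \<open>G\<close>.\<close>

definition free_extend :: "('b, 'c) monoid_scheme \<Rightarrow> ('a \<Rightarrow> 'b) \<Rightarrow> 'a letter list \<Rightarrow> 'b" where
  "free_extend G f w =
     foldr (\<lambda>(g, e) p. (if e then f g else inv\<^bsub>G\<^esub> f g) \<otimes>\<^bsub>G\<^esub> p) w \<one>\<^bsub>G\<^esub>"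

lemma inv_letter_inv_letter [simp]: "inv_letter (inv_letter a) = a"
  by (simp add: inv_letter_def)

lemma inv_letter_neq [simp]: "inv_letter a \<noteq> a" "a \<noteq> inv_letter a"
  by (auto simp: inv_letter_def prod_eq_iff)

lemma reduced_Cons:
  "reduced (a # w) \<longleftrightarrow> reduced w \<and> (w = [] \<or> hd w \<noteq> inv_letter a)"
  by (cases w) (auto simp: reduced_def)

lemma reduced_Nil [simp]: "reduced []"
  by (simp add: reduced_def)

lemma reduced_cancel_cons: "reduced w \<Longrightarrow> reduced (cancel_cons a w)"
  by (cases w) (auto simp: reduced_Cons)

lemma reduced_foldr: "reduced w \<Longrightarrow> reduced (foldr cancel_cons u w)"
  by (induction u) (auto intro: reduced_cancel_cons)

lemma cancel_cons_inv_letter: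
  "reduced w \<Longrightarrow> cancel_cons a (cancel_cons (inv_letter a) w) = w"
  by (cases w; cases "tl w") (auto simp: reduced_Cons)

lemma foldr_cancel_cons:
  assumes "reduced v" "reduced w"
  shows "foldr cancel_cons (cancel_cons a v) w = cancel_cons a (foldr cancel_cons v w)"
  using assms by (cases v) (auto simp: cancel_cons_inv_letter reduced_foldr reduced_Cons)

lemma foldr_cancel_cons_assoc:
  assumes "reduced v" "reduced w"
  shows "foldr cancel_cons (foldr cancel_cons u v) w = foldr cancel_cons u (foldr cancel_cons v w)"
  using assms by (induction u) (auto simp: foldr_cancel_cons reduced_foldr)

lemma foldr_cancel_cons_Nil: "reduced u \<Longrightarrow> foldr cancel_cons u [] = u"
proof (induction u)
  case (Cons a u)
  then show ?case by (cases u) (auto simp: reduced_Cons)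
qed simp

lemma foldr_cancel_cons_rev:
  "reduced w \<Longrightarrow> foldr cancel_cons (rev (map inv_letter u)) (foldr cancel_cons u w) = w"
proof (induction u arbitrary: w)
  case (Cons a u)
  then show ?case
    using cancel_cons_inv_letter[of "foldr cancel_cons u w" "inv_letter a"]
    by (simp add: reduced_foldr)
qed simp

lemma group_free_group: "group free_group"
proof (rule groupI)
  fix u :: "'a letter list" assume "u \<in> carrier free_group"
  hence u: "foldr cancel_cons u [] = u"
    by (simp add: free_group_def foldr_cancel_cons_Nil)
  let ?v = "foldr cancel_cons (rev (map inv_letter u)) []"
  have "foldr cancel_cons ?v (foldr cancel_cons u []) = []"
    by (metis foldr_cancel_cons_assoc foldr_cancel_cons_rev reduced_Nil foldr.simps(1)
        id_apply reduced_foldr)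
  thus "\<exists>v\<in>carrier free_group. v \<otimes>\<^bsub>free_group\<^esub> u = \<one>\<^bsub>free_group\<^esub>"
    by (intro bexI[of _ ?v]) (auto simp: free_group_def u reduced_foldr)
qed (auto simp: free_group_def reduced_foldr foldr_cancel_cons_assoc)

lemma (in group) free_extend_closed:
  "range f \<subseteq> carrier G \<Longrightarrow> free_extend G f w \<in> carrier G"
  by (induction w) (auto simp: free_extend_def image_subset_iff)

lemma (in group) free_extend_cancel_cons:
  assumes f: "range f \<subseteq> carrier G"
  shows "free_extend G f (cancel_cons a w) = free_extend G f [a] \<otimes> free_extend G f w"
proof (cases w)
  case Nil
  thus ?thesis using f by (cases a) (auto simp: free_extend_def image_subset_iff)
next
  case (Cons b v)
  have "free_extend G f v \<in> carrier G" "f (fst a) \<in> carrier G" "f (fst b) \<in> carrier G"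
    using f free_extend_closed by auto
  thus ?thesis using Cons
    by (cases a; cases b) (auto simp: free_extend_def inv_letter_def m_assoc[symmetric])
qed

lemma (in group) free_extend_hom:
  assumes f: "range f \<subseteq> carrier G"
  shows "free_extend G f \<in> hom free_group G"
proof (rule homI)
  show "free_extend G f w \<in> carrier G" for w
    using f by (rule free_extend_closed)
  have step: "free_extend G f (a # u) = free_extend G f [a] \<otimes> free_extend G f u" for a u
  proof -
    have "free_extend G f u \<in> carrier G" "f (fst a) \<in> carrier G"
      using f free_extend_closed by auto
    thus ?thesis by (cases a) (auto simp: free_extend_def)
  qed
  have "free_extend G f (foldr cancel_cons u v) = free_extend G f u \<otimes> free_extend G f v" for u v
  proof (induction u)
    case Nil
    show ?case using free_extend_closed[OF f, of v] by (simp add: free_extend_def)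
  next
    case (Cons a u)
    have "free_extend G f (foldr cancel_cons (a # u) v)
        = free_extend G f [a] \<otimes> (free_extend G f u \<otimes> free_extend G f v)"
      by (simp add: free_extend_cancel_cons[OF f] Cons)
    also have "\<dots> = free_extend G f (a # u) \<otimes> free_extend G f v"
      unfolding step[of a u] by (simp add: m_assoc free_extend_closed[OF f])
    finally show ?case .
  qed
  thus "free_extend G f (u \<otimes>\<^bsub>free_group\<^esub> v) = free_extend G f u \<otimes> free_extend G f v" for u v
    by (simp add: free_group_def)
qed


section \<open>The groups $SL(2,R)$ and $PSL(2,R)$\<close>

definition SL2R :: "(real^2^2) monoid" where
  "SL2R = \<lparr>carrier = {A. det A = 1}, mult = (**), one = mat 1\<rparr>"

definition PSL2R :: "(real^2^2) set monoid" where
  "PSL2R = SL2R Mod {mat 1, - mat 1}"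

definition PSL2R_proj :: "real^2^2 \<Rightarrow> (real^2^2) set" where
  "PSL2R_proj A = {mat 1, - mat 1} #>\<^bsub>SL2R\<^esub> A"

lemma group_SL2R: "group SL2R"
proof (rule groupI)
  fix A assume "A \<in> carrier SL2R"
  hence A: "det A = 1" by (simp add: SL2R_def)
  hence "invertible A" by (simp add: invertible_det_nz)
  then obtain B where B: "B ** A = mat 1" unfolding invertible_def by blast
  hence "det B * det A = 1" by (metis det_I det_mul)
  with A B show "\<exists>B\<in>carrier SL2R. B \<otimes>\<^bsub>SL2R\<^esub> A = \<one>\<^bsub>SL2R\<^esub>"
    by (intro bexI[of _ B]) (auto simp: SL2R_def)
qed (auto simp: SL2R_def det_mul matrix_mul_assoc)

lemma normal_pm_one: "{mat 1, - mat 1} \<lhd> SL2R"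
proof -
  interpret group SL2R by (rule group_SL2R)
  have neg: "A ** (- mat 1) = - A" "(- mat 1) ** A = - A" for A :: "real^2^2"
    by (simp_all add: vec_eq_iff matrix_matrix_mult_def mat_def forall_2 sum_2)
  have d: "det (- mat 1 :: real^2^2) = 1" by (simp add: det_2 mat_def)
  have i: "inv\<^bsub>SL2R\<^esub> (- mat 1) = - mat 1"
    by (rule inv_equality) (auto simp: SL2R_def neg d)
  have i1: "inv\<^bsub>SL2R\<^esub> (mat 1) = mat 1"
    by (rule inv_equality) (auto simp: SL2R_def)
  have "subgroup {mat 1, - mat 1} SL2R"
    by (rule subgroupI) (auto simp: i i1, auto simp: SL2R_def neg d)
  thus ?thesis
    unfolding normal_def normal_axioms_def r_coset_def l_coset_def
    using group_SL2R by (auto simp: SL2R_def neg)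
qed

lemma group_PSL2R: "group PSL2R"
  unfolding PSL2R_def by (rule normal.factorgroup_is_group[OF normal_pm_one])

lemma PSL2R_proj_hom: "PSL2R_proj \<in> hom SL2R PSL2R"
  using normal.r_coset_hom_Mod[OF normal_pm_one] by (simp add: PSL2R_def PSL2R_proj_def[abs_def])


section \<open>The Fricke--Klein space and the holonomy\<close>

definition fricke_klein :: "real \<Rightarrow> (real \<times> real \<times> real) set" where
  "fricke_klein \<theta> = {(x, y, z). x > 2 \<and> y > 2 \<and> z > 2 \<and>
     x\<^sup>2 + y\<^sup>2 + z\<^sup>2 - x * y * z - 2 = - 2 * cos (\<theta> / 2)}"

datatype torus_gen = Gen_X | Gen_Y

text \<open>The group \<open>\<langle>X, Y, Z | XYZ = 1\<rangle>\<close>, with \<open>Z\<close> eliminated as \<open>(XY)\<inverse>\<close>.\<close>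

abbreviation F2 :: "torus_gen letter list monoid" where
  "F2 \<equiv> free_group"

definition F2_X :: "torus_gen letter list" where
  "F2_X = [(Gen_X, True)]"

definition F2_Y :: "torus_gen letter list" where
  "F2_Y = [(Gen_Y, True)]"

definition F2_Z :: "torus_gen letter list" where
  "F2_Z = inv\<^bsub>F2\<^esub> (F2_X \<otimes>\<^bsub>F2\<^esub> F2_Y)"

definition zeta :: "real \<Rightarrow> real" where
  "zeta z = (THE \<zeta>. \<zeta> \<ge> 1 \<and> \<zeta> + inverse \<zeta> = z)"

fun holonomy_gen :: "real \<times> real \<times> real \<Rightarrow> torus_gen \<Rightarrow> real^2^2" where
  "holonomy_gen (x, y, z) Gen_X = vector [vector [x, -1], vector [1, 0]]"
| "holonomy_gen (x, y, z) Gen_Y = vector [vector [0, inverse (zeta z)], vector [- zeta z, y]]"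

definition holonomy_SL :: "real \<times> real \<times> real \<Rightarrow> torus_gen letter list \<Rightarrow> real^2^2" where
  "holonomy_SL \<xi> = free_extend SL2R (holonomy_gen \<xi>)"

text \<open>The holonomy of a cone structure is only defined up to conjugation by isometries of the
  hyperbolic plane; this is the explicit representative of that class. Which elements of the free
  group it kills does not depend on the representative.\<close>

definition holonomy :: "real \<times> real \<times> real \<Rightarrow> torus_gen letter list \<Rightarrow> (real^2^2) set" where
  "holonomy \<xi> w = PSL2R_proj (holonomy_SL \<xi> w)"

lemma zeta:
  assumes "z \<ge> 2"
  shows "zeta z \<ge> 1" "zeta z + inverse (zeta z) = z"
proof -
  define s where "s = (z + sqrt (z\<^sup>2 - 4)) / 2"
  have "2\<^sup>2 \<le> z\<^sup>2" by (rule power_mono) (use assms in auto)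
  hence sq: "(sqrt (z\<^sup>2 - 4))\<^sup>2 = z\<^sup>2 - 4" "sqrt (z\<^sup>2 - 4) \<ge> 0" by auto
  have s1: "s \<ge> 1" using add_mono[OF assms sq(2)] by (simp add: s_def)
  have ss: "s * s + 1 = z * s" using sq by (simp add: s_def power2_eq_square field_simps)
  hence s2: "s + inverse s = z" using s1 by (simp add: field_simps)
  have "t = s" if t: "t \<ge> 1" "t + inverse t = z" for t
  proof -
    have tt: "t * t + 1 = z * t" using t by (simp add: field_simps)
    have "(t - s) * (t * s - 1) = s * (t * t + 1) - t * (s * s + 1)" by (simp add: algebra_simps)
    also have "\<dots> = 0" using ss tt by simp
    finally have "(t - s) * (t * s - 1) = 0" .
    moreover have "t = s" if "t * s = 1"
    proof -
      have "t * s \<ge> t" "t * s \<ge> s" using s1 t by (simp_all add: mult_le_cancel_left1 mult_le_cancel_right1)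
      with that s1 t show ?thesis by linarith
    qed
    ultimately show ?thesis by auto
  qed
  hence "zeta z = s" unfolding zeta_def using s1 s2 by (intro the_equality) blast+
  thus "zeta z \<ge> 1" "zeta z + inverse (zeta z) = z" using s1 s2 by simp_all
qed

lemma holonomy_gen_SL2R:
  assumes "\<xi> \<in> fricke_klein \<theta>"
  shows "range (holonomy_gen \<xi>) \<subseteq> carrier SL2R"
proof -
  obtain x y z where \<xi>: "\<xi> = (x, y, z)" "z > 2" using assms by (auto simp: fricke_klein_def)
  have "zeta z \<noteq> 0" using zeta(1)[of z] \<xi> by auto
  hence "holonomy_gen \<xi> g \<in> carrier SL2R" for g
    using \<xi> by (cases g) (auto simp: SL2R_def det_2)
  thus ?thesis by auto
qed

lemma holonomy_hom:
  assumes "\<xi> \<in> fricke_klein \<theta>"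
  shows "holonomy_SL \<xi> \<in> hom F2 SL2R" "holonomy \<xi> \<in> hom F2 PSL2R"
proof -
  show "holonomy_SL \<xi> \<in> hom F2 SL2R"
    unfolding holonomy_SL_def
    by (rule group.free_extend_hom[OF group_SL2R holonomy_gen_SL2R[OF assms]])
  from hom_compose[OF this PSL2R_proj_hom] show "holonomy \<xi> \<in> hom F2 PSL2R"
    by (simp add: holonomy_def[abs_def] comp_def)
qed

lemma holonomy_trace:
  assumes "(x, y, z) \<in> fricke_klein \<theta>"
  shows "trace (holonomy_SL (x, y, z) F2_X) = x"
    and "trace (holonomy_SL (x, y, z) F2_Y) = y"
    and "trace (holonomy_SL (x, y, z) F2_Z) = z"
proof -
  have z: "z > 2" using assms by (auto simp: fricke_klein_def)
  note zeta = zeta[of z]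
  interpret F: group "F2" by (rule group_free_group)
  interpret S: group SL2R by (rule group_SL2R)
  let ?h = "holonomy_SL (x, y, z)"
  interpret h: group_hom F2 SL2R ?h
    by unfold_locales (rule holonomy_hom[OF assms])
  have X: "?h F2_X = vector [vector [x, -1], vector [1, 0]]"
    and Y: "?h F2_Y = vector [vector [0, inverse (zeta z)], vector [- zeta z, y]]"
    by (auto simp: holonomy_SL_def free_extend_def F2_X_def F2_Y_def SL2R_def)
  show "trace (?h F2_X) = x" "trace (?h F2_Y) = y"
    unfolding X Y by (auto simp: trace_def sum_2)
  have c: "F2_X \<in> carrier F2" "F2_Y \<in> carrier F2"
    by (auto simp: free_group_def F2_X_def F2_Y_def reduced_Cons)
  have "?h F2_Z = inv\<^bsub>SL2R\<^esub> (?h F2_X \<otimes>\<^bsub>SL2R\<^esub> ?h F2_Y)"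
    using c by (simp add: F2_Z_def)
  also have "\<dots> = vector [vector [inverse (zeta z), y - x * inverse (zeta z)], vector [0, zeta z]]"
    using zeta z
    by (intro S.inv_equality)
       (auto simp: X Y SL2R_def det_2 vec_eq_iff matrix_matrix_mult_def mat_def forall_2 sum_2
         field_simps)
  finally show "trace (?h F2_Z) = z" using zeta z by (simp add: trace_def sum_2 add.commute)
qed

end

theory Submission
  imports Defs
begin

text \<open>If \<open>k = [X, Y]\<close>, then \<open>tr (Y k\<^sup>n)\<close> depends on \<open>y\<close> and \<open>\<theta>\<close> only: \<open>Y k\<close> is conjugate to \<open>Y\<close> and
  \<open>tr k = - 2 cos (\<theta> / 2) = 2 cos \<phi>\<close> with \<open>\<phi> = \<pi> - \<theta> / 2\<close>, so the trace recursion gives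
  \<open>tr (Y k\<^sup>n) = y cos ((n - 1/2) \<phi>) / cos (\<phi> / 2)\<close>. As \<open>\<phi> / \<pi>\<close> is irrational, the values of \<open>y\<close> for
  which this trace is \<open>1\<close> for some \<open>n\<close> are dense in \<open>(2, \<infinity>)\<close>, and an element of trace \<open>1\<close> has
  order \<open>3\<close> in \<open>PSL(2,R)\<close>. The same works with \<open>X\<inverse>\<close> or \<open>Z\<close> in place of \<open>Y\<close>.\<close>

section \<open>Two-by-two real matrices of determinant 1\<close>

text \<open>Cayley-Hamilton, \<open>B ** B = trace B * B - 1\<close>, multiplied by \<open>A\<close>
  on the left; this drives every trace recursion below.\<close>

lemma trace_mult_square:
  fixes A B :: "real^2^2"
  assumes "det B = 1"
  shows "trace (A ** B ** B) = trace B * trace (A ** B) - trace A"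
proof -
  have d: "B$1$1 * B$2$2 = 1 + B$1$2 * B$2$1"
    using assms by (simp add: det_2)
  have "trace (A ** B ** B) - trace B * trace (A ** B) + trace A
      = (A$1$1 + A$2$2) * (1 + B$1$2 * B$2$1 - B$1$1 * B$2$2)"
    by (simp add: trace_def sum_2 matrix_matrix_mult_def algebra_simps)
  also have "\<dots> = 0"
    using d by simp
  finally show ?thesis
    by simp
qed

text \<open>By Cayley-Hamilton \<open>A\<close> is a root of \<open>t^2 - t + 1\<close>, a divisor
  of \<open>t^3 + 1\<close>.\<close>

lemma cube_eq_minus_one:
  fixes A :: "real^2^2"
  assumes "det A = 1" "trace A = 1"
  shows "A ** A ** A = - mat 1"
proof -
  have t: "A$2$2 = 1 - A$1$1"
    using assms(2) by (simp add: trace_def sum_2)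
  have d: "A$1$2 * A$2$1 = A$1$1 - A$1$1 * A$1$1 - 1"
    using assms(1) by (simp add: det_2 t algebra_simps)
  have sq: "A ** A = A - mat 1"
    using d by (simp add: vec_eq_iff matrix_matrix_mult_def mat_def forall_2 sum_2 t algebra_simps)
  have "A ** A ** A = (A - mat 1) ** A"
    by (simp only: sq)
  also have "\<dots> = A ** A - A"
    by (simp add: vec_eq_iff matrix_matrix_mult_def mat_def forall_2 sum_2 algebra_simps)
  finally show ?thesis
    by (simp add: sq)
qed

lemma (in group) mult_inv_cancel:
  assumes "a \<in> carrier G" "b \<in> carrier G"
  shows "a \<otimes> (inv a \<otimes> b) = b" "inv a \<otimes> (a \<otimes> b) = b"
  using assms by (simp_all add: m_assoc[symmetric])

section \<open>Trace identities in SL(2,R)\<close>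

interpretation SL2R: group SL2R
  by (rule group_SL2R)

lemma SL2R_trace_commute: "trace (A \<otimes>\<^bsub>SL2R\<^esub> B) = trace (B \<otimes>\<^bsub>SL2R\<^esub> A)"
  using trace_mul_sym[of A B] by (simp add: SL2R_def)

lemma SL2R_trace_mult_inv:
  assumes "A \<in> carrier SL2R" "B \<in> carrier SL2R"
  shows "trace (A \<otimes>\<^bsub>SL2R\<^esub> inv\<^bsub>SL2R\<^esub> B) = trace A * trace B - trace (A \<otimes>\<^bsub>SL2R\<^esub> B)"
proof -
  \<comment> \<open>The recursion is applied to \<open>?C\<close>, for which \<open>?C B = A\<close>
    and \<open>?C B B = A B\<close>.\<close>
  let ?C = "A \<otimes>\<^bsub>SL2R\<^esub> inv\<^bsub>SL2R\<^esub> B"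
  have C: "?C \<otimes>\<^bsub>SL2R\<^esub> B = A"
    using assms by (simp add: SL2R.m_assoc)
  have "trace (?C \<otimes>\<^bsub>SL2R\<^esub> B \<otimes>\<^bsub>SL2R\<^esub> B) = trace B * trace (?C \<otimes>\<^bsub>SL2R\<^esub> B) - trace ?C"
    using trace_mult_square[of B ?C] assms by (simp add: SL2R_def)
  thus ?thesis
    by (simp add: C)
qed

lemma SL2R_trace_one: "trace \<one>\<^bsub>SL2R\<^esub> = 2"
  by (simp add: SL2R_def trace_def sum_2 mat_def)

lemma SL2R_trace_inv:
  assumes "A \<in> carrier SL2R"
  shows "trace (inv\<^bsub>SL2R\<^esub> A) = trace A"
  using SL2R_trace_mult_inv[OF SL2R.one_closed assms] assms by (simp add: SL2R_trace_one)

lemma SL2R_trace_conj: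
  assumes "A \<in> carrier SL2R" "B \<in> carrier SL2R"
  shows "trace (A \<otimes>\<^bsub>SL2R\<^esub> B \<otimes>\<^bsub>SL2R\<^esub> inv\<^bsub>SL2R\<^esub> A) = trace B"
  using assms by (subst SL2R_trace_commute) (simp add: SL2R.m_assoc[symmetric])

abbreviation commutator :: "('a, 'b) monoid_scheme \<Rightarrow> 'a \<Rightarrow> 'a \<Rightarrow> 'a" where
  "commutator G a b \<equiv> a \<otimes>\<^bsub>G\<^esub> b \<otimes>\<^bsub>G\<^esub> inv\<^bsub>G\<^esub> a \<otimes>\<^bsub>G\<^esub> inv\<^bsub>G\<^esub> b"

text \<open>Fricke's identity. Its right-hand side is the polynomial in the equation of
  \<open>fricke_klein\<close>, so that equation prescribes the trace of the commutator.\<close>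

lemma SL2R_trace_commutator:
  assumes A: "A \<in> carrier SL2R" and B: "B \<in> carrier SL2R"
  shows "trace (commutator SL2R A B) = (trace A)\<^sup>2 + (trace B)\<^sup>2 + (trace (A \<otimes>\<^bsub>SL2R\<^esub> B))\<^sup>2
      - trace A * trace B * trace (A \<otimes>\<^bsub>SL2R\<^esub> B) - 2"
proof -
  note [simp] = A B
  let ?D = "inv\<^bsub>SL2R\<^esub> A \<otimes>\<^bsub>SL2R\<^esub> B"
  \<comment> \<open>The product rule removes the last inverse; the remaining factor
    \<open>A B (inv A)\<close> is a conjugate of \<open>B\<close>.\<close>
  have "trace (commutator SL2R A B) = trace B * trace B - trace (A \<otimes>\<^bsub>SL2R\<^esub> B \<otimes>\<^bsub>SL2R\<^esub> ?D)"
    using SL2R_trace_mult_inv[of "A \<otimes>\<^bsub>SL2R\<^esub> B \<otimes>\<^bsub>SL2R\<^esub> inv\<^bsub>SL2R\<^esub> A" B] SL2R_trace_conj[OF A B]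
    by (simp add: SL2R.m_assoc)
  \<comment> \<open>A second use of the product rule, chosen so that \<open>A B (inv ?D)\<close>
    collapses to \<open>A A\<close>.\<close>
  moreover have "trace (A \<otimes>\<^bsub>SL2R\<^esub> B \<otimes>\<^bsub>SL2R\<^esub> inv\<^bsub>SL2R\<^esub> ?D)
      = trace (A \<otimes>\<^bsub>SL2R\<^esub> B) * trace ?D - trace (A \<otimes>\<^bsub>SL2R\<^esub> B \<otimes>\<^bsub>SL2R\<^esub> ?D)"
    by (rule SL2R_trace_mult_inv) simp_all
  moreover have "A \<otimes>\<^bsub>SL2R\<^esub> B \<otimes>\<^bsub>SL2R\<^esub> inv\<^bsub>SL2R\<^esub> ?D = A \<otimes>\<^bsub>SL2R\<^esub> A"
    by (simp add: SL2R.inv_mult_group SL2R.m_assoc SL2R.mult_inv_cancel)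
  moreover have "trace (A \<otimes>\<^bsub>SL2R\<^esub> A) = trace A * trace A - 2"
    using SL2R_trace_mult_inv[OF A A] by (simp add: SL2R_trace_one)
  moreover have "trace ?D = trace A * trace B - trace (A \<otimes>\<^bsub>SL2R\<^esub> B)"
    using SL2R_trace_mult_inv[OF B A] SL2R_trace_commute[of B A]
      SL2R_trace_commute[of B "inv\<^bsub>SL2R\<^esub> A"] by simp
  ultimately show ?thesis
    by (simp add: power2_eq_square algebra_simps)
qed

text \<open>Both sides satisfy \<open>t (n + 2) = 2 * cos \<phi> * t (n + 1) - t n\<close>. The
  shift by \<open>1 / 2\<close> reflects the equal values at 0 and 1, since cosine is even.\<close>

lemma SL2R_trace_mult_pow:
  assumes A: "A \<in> carrier SL2R" and K: "K \<in> carrier SL2R"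
    and a: "trace A = a" "trace (A \<otimes>\<^bsub>SL2R\<^esub> K) = a" and k: "trace K = 2 * cos \<phi>"
  shows "trace (A \<otimes>\<^bsub>SL2R\<^esub> K [^]\<^bsub>SL2R\<^esub> n) * cos (\<phi> / 2) = a * cos ((real n - 1 / 2) * \<phi>)"
proof (induction n rule: induct_nat_012)
  case 0
  show ?case
    using A a by simp
next
  case 1
  show ?case
    using K a by simp
next
  case (ge2 n)
  let ?t = "\<lambda>n::nat. trace (A \<otimes>\<^bsub>SL2R\<^esub> K [^]\<^bsub>SL2R\<^esub> n)"
  have "?t (Suc (Suc n)) = trace (A \<otimes>\<^bsub>SL2R\<^esub> K [^]\<^bsub>SL2R\<^esub> n \<otimes>\<^bsub>SL2R\<^esub> K \<otimes>\<^bsub>SL2R\<^esub> K)"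
    using A K by (simp add: SL2R.m_assoc)
  also have "\<dots> = trace K * trace (A \<otimes>\<^bsub>SL2R\<^esub> K [^]\<^bsub>SL2R\<^esub> n \<otimes>\<^bsub>SL2R\<^esub> K) - ?t n"
    using trace_mult_square[of K "A \<otimes>\<^bsub>SL2R\<^esub> K [^]\<^bsub>SL2R\<^esub> n"] K by (simp add: SL2R_def)
  also have "\<dots> = 2 * cos \<phi> * ?t (Suc n) - ?t n"
    using A K k by (simp add: SL2R.m_assoc)
  finally have "?t (Suc (Suc n)) * cos (\<phi> / 2)
      = 2 * cos \<phi> * (?t (Suc n) * cos (\<phi> / 2)) - ?t n * cos (\<phi> / 2)"
    by (simp only: left_diff_distrib mult.assoc)
  also have "\<dots> = a * (2 * cos \<phi> * cos ((real (Suc n) - 1 / 2) * \<phi>) - cos ((real n - 1 / 2) * \<phi>))"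
    unfolding ge2 by (simp add: algebra_simps)
  also have "2 * cos \<phi> * cos ((real (Suc n) - 1 / 2) * \<phi>)
      = cos ((real n - 1 / 2) * \<phi>) + cos ((real (Suc (Suc n)) - 1 / 2) * \<phi>)"
  proof -
    have e: "(real n - 1 / 2) * \<phi> = (real (Suc n) - 1 / 2) * \<phi> - \<phi>"
      "(real (Suc (Suc n)) - 1 / 2) * \<phi> = (real (Suc n) - 1 / 2) * \<phi> + \<phi>"
      by (simp_all add: algebra_simps)
    show ?thesis
      unfolding e cos_add cos_diff by simp
  qed
  finally show ?case
    by simp
qed

section \<open>Torsion in the image of the holonomy\<close>

lemma PSL2R_proj_cube:
  assumes "A \<in> carrier SL2R" "trace A = 1"
  shows "PSL2R_proj (A [^]\<^bsub>SL2R\<^esub> (3::nat)) = \<one>\<^bsub>PSL2R\<^esub>"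
proof -
  have "A [^]\<^bsub>SL2R\<^esub> (3::nat) = - mat 1"
    using cube_eq_minus_one[of A] assms by (simp add: numeral_3_eq_3 SL2R_def)
  moreover have "{mat 1, - mat 1} #>\<^bsub>SL2R\<^esub> (- mat 1) = {mat 1, - mat 1}"
    by (rule subgroup.rcos_const[OF normal_imp_subgroup[OF normal_pm_one] group_SL2R]) simp
  ultimately show ?thesis
    by (simp add: PSL2R_proj_def PSL2R_def FactGroup_def)
qed

text \<open>After division by \<open>cos (\<phi> / 2)\<close>, the condition says that the trace in
  \<open>SL2R_trace_mult_pow\<close> is 1 for some \<open>n\<close>. Only the cone angle enters, so
  one set serves all three coordinates.\<close>

definition torsion_params :: "real \<Rightarrow> real set" where
  "torsion_params \<phi> = {a. a > 2 \<and> (\<exists>n::nat. a * cos ((real n - 1 / 2) * \<phi>) = cos (\<phi> / 2))}"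

lemma holonomy_torsion:
  assumes \<xi>: "\<xi> \<in> fricke_klein \<theta>" and a: "a \<in> carrier F2" and k: "k \<in> carrier F2"
    and t: "trace (holonomy_SL \<xi> a) = t" "trace (holonomy_SL \<xi> (a \<otimes>\<^bsub>F2\<^esub> k)) = t"
    and tk: "trace (holonomy_SL \<xi> k) = 2 * cos \<phi>"
    and \<phi>: "cos (\<phi> / 2) \<noteq> 0" "t \<in> torsion_params \<phi>"
  shows "\<exists>r \<in> carrier F2 - {\<one>\<^bsub>F2\<^esub>}. \<exists>m::nat. m \<ge> 2 \<and> holonomy \<xi> (r [^]\<^bsub>F2\<^esub> m) = \<one>\<^bsub>PSL2R\<^esub>"
proof -
  interpret h: group_hom F2 SL2R "holonomy_SL \<xi>"
    by (intro group_hom.intro group_hom_axioms.intro group_free_group group_SL2R holonomy_hom(1)[OF \<xi>])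
  obtain n :: nat where n: "t * cos ((real n - 1 / 2) * \<phi>) = cos (\<phi> / 2)"
    using \<phi> by (auto simp: torsion_params_def)
  define r where "r = a \<otimes>\<^bsub>F2\<^esub> k [^]\<^bsub>F2\<^esub> n"
  have r: "r \<in> carrier F2"
    using a k by (simp add: r_def)
  have "trace (holonomy_SL \<xi> r) * cos (\<phi> / 2) = t * cos ((real n - 1 / 2) * \<phi>)"
    using SL2R_trace_mult_pow[of "holonomy_SL \<xi> a" "holonomy_SL \<xi> k" t \<phi> n] a k t tk
    by (simp add: r_def h.hom_nat_pow)
  hence tr: "trace (holonomy_SL \<xi> r) = 1"
    using n \<phi> by simp
  \<comment> \<open>The identity has trace 2, not 1.\<close>
  hence "r \<noteq> \<one>\<^bsub>F2\<^esub>"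
    by (auto simp: SL2R_trace_one)
  moreover have "holonomy \<xi> (r [^]\<^bsub>F2\<^esub> (3::nat)) = \<one>\<^bsub>PSL2R\<^esub>"
    using PSL2R_proj_cube[of "holonomy_SL \<xi> r"] r tr by (simp add: holonomy_def h.hom_nat_pow)
  ultimately show ?thesis
    using r by (intro bexI[of _ r] exI[of _ 3]) auto
qed

section \<open>Density of the torsion parameters\<close>

text \<open>By Kronecker's theorem the angles \<open>(n - 1/2) * \<phi>\<close> are dense modulo
  \<open>2 * pi\<close>, and \<open>cos (\<phi> / 2) / cos t\<close> is continuous wherever
  \<open>cos t\<close> is nonzero.\<close>

lemma torsion_params_dense:
  assumes \<phi>: "\<phi> / (2 * pi) \<notin> \<rat>" and c: "0 < cos (\<phi> / 2)"
  shows "{2<..} \<subseteq> closure (torsion_params \<phi>)"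
proof
  fix u :: real
  assume "u \<in> {2<..}"
  hence u: "u > 2" by simp
  \<comment> \<open>The angle at which \<open>cos (\<phi> / 2) / cos t\<close> equals the target
    \<open>u\<close>.\<close>
  define \<alpha> where "\<alpha> = arccos (cos (\<phi> / 2) / u)"
  have "cos (\<phi> / 2) / u \<le> 1" "- 1 \<le> cos (\<phi> / 2) / u"
    using u c order_trans[OF cos_le_one[of "\<phi> / 2"], of u] by (auto simp: field_simps)
  hence \<alpha>: "cos \<alpha> = cos (\<phi> / 2) / u"
    by (simp add: \<alpha>_def)
  define g where "g = (\<lambda>t. cos (\<phi> / 2) / cos t)"
  have g: "g \<alpha> = u" "isCont g \<alpha>"
    using c u \<alpha> by (auto simp: g_def intro!: continuous_intros)
  show "u \<in> closure (torsion_params \<phi>)"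
  proof (unfold closure_approachable, intro allI impI)
    fix e :: real
    assume "e > 0"
    \<comment> \<open>The bound \<open>u - 2\<close> keeps the approximating value above 2.\<close>
    hence "min e (u - 2) > 0" using u by simp
    then obtain d where d: "d > 0" "\<And>t. dist t \<alpha> < d \<Longrightarrow> dist (g t) u < min e (u - 2)"
      using g unfolding continuous_at_eps_delta by metis
    \<comment> \<open>Adding \<open>\<phi> / 2\<close> to the target absorbs the half-integer shift;
      \<open>k > 0\<close> lets \<open>k\<close> be read as a natural number.\<close>
    obtain h k where k: "k > 0"
      "\<bar>of_int k * (\<phi> / (2 * pi)) - of_int h - (\<alpha> + \<phi> / 2) / (2 * pi)\<bar> < d / (2 * pi)"
      using sequence_of_fractional_parts_is_dense[OF \<phi>, of "d / (2 * pi)" "(\<alpha> + \<phi> / 2) / (2 * pi)"] d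
      by (metis divide_pos_pos pi_gt_zero zero_less_mult_iff zero_less_numeral)
    define n where "n = nat k"
    define t where "t = (real n - 1 / 2) * \<phi> - 2 * pi * of_int h"
    have "(t - \<alpha>) / (2 * pi) = (of_int k * (\<phi> / (2 * pi)) - of_int h - (\<alpha> + \<phi> / 2) / (2 * pi))"
      using k by (simp add: t_def n_def field_simps)
    hence "\<bar>(t - \<alpha>) / (2 * pi)\<bar> < d / (2 * pi)"
      using k(2) by simp
    hence "dist t \<alpha> < d"
      by (simp add: dist_real_def abs_divide divide_less_cancel)
    hence gt: "dist (g t) u < e" "g t > 2"
      using d(2)[of t] by (auto simp: dist_real_def)
    have "cos t = cos ((real n - 1 / 2) * \<phi>)"
      unfolding t_def cos_diff cos_int_2pin sin_int_2pin by simp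
    \<comment> \<open>Here \<open>cos t\<close> is nonzero: division by zero would give
      \<open>g t = 0\<close>, against \<open>g t > 2\<close>.\<close>
    hence "g t * cos ((real n - 1 / 2) * \<phi>) = cos (\<phi> / 2)"
      using gt(2) by (auto simp: g_def)
    thus "\<exists>y\<in>torsion_params \<phi>. dist y u < e"
      using gt by (auto simp: torsion_params_def)
  qed
qed

section \<open>Application to the three trace coordinates\<close>

theorem theorem5p2:
  fixes \<theta> :: real
  assumes "\<theta> \<in> {0<..<2 * pi} - {q * pi | q. q \<in> \<rat>}"
  shows "\<exists>S::real set. S \<subseteq> {2<..} \<and> {2<..} \<subseteq> closure S \<and>
    (\<forall>\<xi> \<in> fricke_klein \<theta> \<inter> (S \<times> UNIV \<times> UNIV).
       \<exists>r \<in> carrier F2 - {\<one>\<^bsub>F2\<^esub>}. \<exists>m::nat. m \<ge> 2 \<and> holonomy \<xi> (r [^]\<^bsub>F2\<^esub> m) = \<one>\<^bsub>PSL2R\<^esub>) \<and>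
    (\<forall>\<xi> \<in> fricke_klein \<theta> \<inter> (UNIV \<times> S \<times> UNIV).
       \<exists>r \<in> carrier F2 - {\<one>\<^bsub>F2\<^esub>}. \<exists>m::nat. m \<ge> 2 \<and> holonomy \<xi> (r [^]\<^bsub>F2\<^esub> m) = \<one>\<^bsub>PSL2R\<^esub>) \<and>
    (\<forall>\<xi> \<in> fricke_klein \<theta> \<inter> (UNIV \<times> UNIV \<times> S).
       \<exists>r \<in> carrier F2 - {\<one>\<^bsub>F2\<^esub>}. \<exists>m::nat. m \<ge> 2 \<and> holonomy \<xi> (r [^]\<^bsub>F2\<^esub> m) = \<one>\<^bsub>PSL2R\<^esub>)"
proof -
  define \<phi> where "\<phi> = pi - \<theta> / 2"
  have \<theta>: "0 < \<theta>" "\<theta> < 2 * pi" "\<And>q. q \<in> \<rat> \<Longrightarrow> \<theta> \<noteq> q * pi"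
    using assms by auto
  have irr: "\<phi> / (2 * pi) \<notin> \<rat>"
  proof
    assume "\<phi> / (2 * pi) \<in> \<rat>"
    \<comment> \<open>This number is \<open>\<theta> / pi\<close>.\<close>
    hence "2 - 4 * (\<phi> / (2 * pi)) \<in> \<rat>" by (intro Rats_diff Rats_mult) auto
    from \<theta>(3)[OF this] show False by (simp add: \<phi>_def field_simps)
  qed
  \<comment> \<open>\<open>\<phi> / 2 = pi / 2 - \<theta> / 4\<close> lies strictly between 0 and
    \<open>pi / 2\<close>.\<close>
  have c: "cos (\<phi> / 2) > 0"
    using \<theta> by (intro cos_gt_zero_pi) (auto simp: \<phi>_def)
  interpret F: group F2
    by (rule group_free_group)
  define k where "k = commutator F2 F2_X F2_Y"
  have X[simp]: "F2_X \<in> carrier F2" and Y[simp]: "F2_Y \<in> carrier F2"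
    by (auto simp: free_group_def F2_X_def F2_Y_def reduced_Cons)
  hence Z[simp]: "F2_Z \<in> carrier F2" and k[simp]: "k \<in> carrier F2"
    by (auto simp: F2_Z_def k_def)
  let ?tors = "\<lambda>\<xi>. \<exists>r \<in> carrier F2 - {\<one>\<^bsub>F2\<^esub>}. \<exists>m::nat. m \<ge> 2 \<and> holonomy \<xi> (r [^]\<^bsub>F2\<^esub> m) = \<one>\<^bsub>PSL2R\<^esub>"
  have tors: "?tors \<xi>"
    if \<xi>: "\<xi> \<in> fricke_klein \<theta>" "\<xi> = (x, y, z)"
      and S: "x \<in> torsion_params \<phi> \<or> y \<in> torsion_params \<phi> \<or> z \<in> torsion_params \<phi>" for \<xi> x y z
  proof -
    interpret h: group_hom F2 SL2R "holonomy_SL \<xi>"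
      by (intro group_hom.intro group_hom_axioms.intro group_free_group group_SL2R
          holonomy_hom(1)[OF \<xi>(1)])
    define A B where "A = holonomy_SL \<xi> F2_X" and "B = holonomy_SL \<xi> F2_Y"
    have AB[simp]: "A \<in> carrier SL2R" "B \<in> carrier SL2R"
      by (auto simp: A_def B_def)
    have hZ: "holonomy_SL \<xi> F2_Z = inv\<^bsub>SL2R\<^esub> (A \<otimes>\<^bsub>SL2R\<^esub> B)"
      and hk: "holonomy_SL \<xi> k = commutator SL2R A B"
      by (auto simp: A_def B_def F2_Z_def k_def)
    have tA: "trace A = x" and tB: "trace B = y" and tZ: "trace (holonomy_SL \<xi> F2_Z) = z"
      using holonomy_trace[of x y z \<theta>] \<xi> by (auto simp: A_def B_def)
    have tAB: "trace (A \<otimes>\<^bsub>SL2R\<^esub> B) = z"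
      using tZ by (simp add: hZ SL2R_trace_inv)
    have "trace (holonomy_SL \<xi> k) = x\<^sup>2 + y\<^sup>2 + z\<^sup>2 - x * y * z - 2"
      by (simp add: hk SL2R_trace_commutator tA tB tAB)
    also have "\<dots> = 2 * cos \<phi>"
      using \<xi> by (simp add: fricke_klein_def \<phi>_def cos_diff)
    finally have tk: "trace (holonomy_SL \<xi> k) = 2 * cos \<phi>" .
    have torsI: "?tors \<xi>" if "a \<in> carrier F2" "trace (holonomy_SL \<xi> a) = t"
      "trace (holonomy_SL \<xi> (a \<otimes>\<^bsub>F2\<^esub> k)) = t" "t \<in> torsion_params \<phi>" for a t
      by (rule holonomy_torsion[OF \<xi>(1) that(1) k that(2,3) tk _ that(4)]) (use c in simp)
    from S consider "x \<in> torsion_params \<phi>" | "y \<in> torsion_params \<phi>" | "z \<in> torsion_params \<phi>"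
      by blast
    thus ?thesis
    proof cases
      case 1
      \<comment> \<open>The inverse of \<open>X\<close> cancels the first letter of
        \<open>k\<close>, leaving a conjugate of that inverse.\<close>
      have "inv\<^bsub>F2\<^esub> F2_X \<otimes>\<^bsub>F2\<^esub> k = F2_Y \<otimes>\<^bsub>F2\<^esub> inv\<^bsub>F2\<^esub> F2_X \<otimes>\<^bsub>F2\<^esub> inv\<^bsub>F2\<^esub> F2_Y"
        by (simp add: k_def F.m_assoc F.mult_inv_cancel)
      hence "trace (holonomy_SL \<xi> (inv\<^bsub>F2\<^esub> F2_X \<otimes>\<^bsub>F2\<^esub> k)) = x"
        by (simp add: A_def[symmetric] B_def[symmetric] SL2R_trace_conj SL2R_trace_inv tA)
      thus ?thesis
        using 1 by (intro torsI[of "inv\<^bsub>F2\<^esub> F2_X" x]) (simp_all add: A_def[symmetric] SL2R_trace_inv tA)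
    next
      case 2
      \<comment> \<open>Cyclic invariance moves \<open>Y\<close> behind \<open>k\<close>, where it
        cancels the last letter and leaves a conjugate of \<open>Y\<close>.\<close>
      have "trace (holonomy_SL \<xi> (F2_Y \<otimes>\<^bsub>F2\<^esub> k)) = trace (commutator SL2R A B \<otimes>\<^bsub>SL2R\<^esub> B)"
        by (subst SL2R_trace_commute[symmetric]) (simp add: hk B_def)
      also have "commutator SL2R A B \<otimes>\<^bsub>SL2R\<^esub> B = A \<otimes>\<^bsub>SL2R\<^esub> B \<otimes>\<^bsub>SL2R\<^esub> inv\<^bsub>SL2R\<^esub> A"
        by (simp add: SL2R.m_assoc)
      finally have "trace (holonomy_SL \<xi> (F2_Y \<otimes>\<^bsub>F2\<^esub> k)) = y"
        by (simp add: SL2R_trace_conj tB)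
      thus ?thesis
        using 2 by (intro torsI[of F2_Y y]) (simp_all add: B_def[symmetric] tB)
    next
      case 3
      \<comment> \<open>\<open>Z\<close>, the inverse of \<open>X Y\<close>, cancels the first two
        letters of \<open>k\<close>; the traces of \<open>Y X\<close> and \<open>X Y\<close>
        agree.\<close>
      have "F2_Z \<otimes>\<^bsub>F2\<^esub> k = inv\<^bsub>F2\<^esub> (F2_Y \<otimes>\<^bsub>F2\<^esub> F2_X)"
        by (simp add: k_def F2_Z_def F.m_assoc F.mult_inv_cancel F.inv_mult_group)
      hence "trace (holonomy_SL \<xi> (F2_Z \<otimes>\<^bsub>F2\<^esub> k)) = z"
        by (simp add: A_def[symmetric] B_def[symmetric] SL2R_trace_inv SL2R_trace_commute[of B A] tAB)
      thus ?thesis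
        using 3 by (intro torsI[of F2_Z z]) (simp_all add: tZ)
    qed
  qed
  show ?thesis
  proof (intro exI[of _ "torsion_params \<phi>"] conjI ballI)
    show "torsion_params \<phi> \<subseteq> {2<..}"
      by (auto simp: torsion_params_def)
    show "{2<..} \<subseteq> closure (torsion_params \<phi>)"
      by (rule torsion_params_dense[OF irr c])
  qed (use tors in blast)+
qed

end
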